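(* Let $U\subset\mathbb{R}^V$ be a linear space of graph signals. Then $U$ is a bandlimited space if and only if $U$, equipped with the standard inner product of $\mathbb{R}^V$, is a shift-invariant graph reproducing kernel Hilbert space (SIGRKHS) whose reproducing kernel is a polynomial filter.
   Context: Let $\mathcal{G}=(V,E,\mathbf{W})$ be a finite, simple, undirected graph with $N\ge 2$ vertices. A graph signal is a vector $\mathbf{x}=[x(v)]_{v\in V}\in\mathbb{R}^V$. A graph shift is a matrix $\mathbf{S}=[s(i,j)]_{i,j\in V}$ with $s(i,j)=0$ unless $i=j$ or $(i,j)\in E$. Standing assumption: $\mathbf{S}_1,\ldots,\mathbf{S}_d$ are graph shifts that are real-valued, symmetric and pairwise commuting. Choose an orthogonal matrix $\mathbf{U}=[\mathbf{u}_1,\ldots,\mathbf{u}_N]$ with $\mathbf{S}_l=\sum_{n=1}^N\lambda_l(n)\mathbf{u}_n\mathbf{u}_n^T$ for $1\le l\le d$, and set $\boldsymbol{\lambda}(n)=[\lambda_1(n),\ldots,\lambda_d(n)]^T\in\mathbb{R}^d$. Let $\boldsymbol{\gamma}(m)$, $1\le m\le M$, be the distinct elements of $\{\boldsymbol{\lambda}(n): 1\le n\le N\}$. Put $\mathbf{P}_m=\sum_{\boldsymbol{\lambda}(n)=\boldsymbol{\gamma}(m)}\mathbf{u}_n\mathbf{u}_n^T$ (independent of the choice of $\mathbf{U}$) and $\widehat{\mathbf{x}}(m)=\mathbf{P}_m\mathbf{x}$ for $\mathbf{x}\in\mathbb{R}^V$. A linear space $U$ of graph signals is bandlimited if $U=B_\Omega:=\{\mathbf{x}\in\mathbb{R}^V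 : \widehat{\mathbf{x}}(m)=\mathbf{0}\ \text{for all}\ m\notin\Omega\}$ for some $\Omega\subset\{1,\ldots,M\}$. A polynomial filter is a matrix of the form $h(\mathbf{S}_1,\ldots,\mathbf{S}_d)$ for some real multivariate polynomial $h$. A graph reproducing kernel Hilbert space (GRKHS) is a Hilbert space $H$ of graph signals (a linear subspace of $\mathbb{R}^V$ with an inner product $\langle\cdot,\cdot\rangle_H$ and norm $\|\cdot\|_H$) such that for every $v\in V$ there is a constant $C_v>0$ with $|x(v)|\le C_v\|\mathbf{x}\|_H$ for all $\mathbf{x}\in H$. Its reproducing kernel is the matrix $\mathbf{K}=[K(v,v')]_{v,v'\in V}$ whose columns $K(\cdot,v)$ lie in $H$ and satisfy $x(v)=\langle\mathbf{x},K(\cdot,v)\rangle_H$ for all $\mathbf{x}\in H$, $v\in V$; one has $H=\{\mathbf{K}\mathbf{c}:\mathbf{c}\in\mathbb{R}^V\}$. An SIGRKHS is a GRKHS whose reproducing kernel satisfies $\mathbf{K}\mathbf{S}_l=\mathbf{S}_l\mathbf{K}$ for all $1\le l\le d$. *)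

theory Defs
  imports "HOL-Analysis.Analysis" "HOL-Library.Poly_Mapping"
begin

text \<open>
  The vertices are the elements of a finite type \<open>'v\<close>, so graph signals are vectors in
  \<open>real ^ 'v\<close>. A finite simple undirected graph on them is given by its symmetric irreflexive
  adjacency relation; the edge weights play no role for shifts.
\<close>

definition simple_graph :: "('v::finite \<times> 'v) set \<Rightarrow> bool" where
  "simple_graph E \<longleftrightarrow> sym E \<and> irrefl E"

definition graph_shift :: "('v::finite \<times> 'v) set \<Rightarrow> real^'v^'v \<Rightarrow> bool" where
  "graph_shift E S \<longleftrightarrow> (\<forall>i j. i \<noteq> j \<and> (i, j) \<notin> E \<longrightarrow> S $ i $ j = 0)"

text \<open>
  A family of \<open>d\<close> shifts is indexed by a finite linearly ordered type \<open>'d\<close> playing the role of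
  \<open>{1, ..., d}\<close>. The order is needed only to fix the order of the factors in a monomial in
  matrices, and is irrelevant when these commute.
\<close>

definition shift_family :: "('v::finite \<times> 'v) set \<Rightarrow> ('d \<Rightarrow> real^'v^'v) \<Rightarrow> bool"
  where
  "shift_family E S \<longleftrightarrow>
     (\<forall>l. graph_shift E (S l)) \<and>
     (\<forall>l. transpose (S l) = S l) \<and>
     (\<forall>k l. S k ** S l = S l ** S k)"


subsection \<open>Joint spectral decomposition and bandlimited spaces\<close>

text \<open>The rank-one matrix \<open>u u\<^sup>T\<close>; the type constraint fixes the inner dimension to one.\<close>

definition rank_one :: "real^'v \<Rightarrow> real^'v^'v::finite" where
  "rank_one u = (columnvector u :: real^1^'v) ** rowvector u"

text \<open>
  \<open>Q\<close> is the orthogonal matrix of joint eigenvectors; its \<open>N = CARD('v)\<close> columns are again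
  indexed by \<open>'v\<close>. The vector \<open>lam n\<close> collects the eigenvalues \<open>(\<lambda>\<^sub>1(n), ..., \<lambda>\<^sub>d(n))\<close>.
\<close>

definition joint_diagonalization ::
  "('d::finite \<Rightarrow> real^'v^'v) \<Rightarrow> real^'v^'v \<Rightarrow> ('v::finite \<Rightarrow> real^'d) \<Rightarrow> bool" where
  "joint_diagonalization S Q lam \<longleftrightarrow>
     orthogonal_matrix Q \<and>
     (\<forall>l. S l = (\<Sum>n\<in>UNIV. (lam n $ l) *\<^sub>R rank_one (column n Q)))"

definition spectral_projection ::
  "real^'v^'v \<Rightarrow> ('v::finite \<Rightarrow> real^'d::finite) \<Rightarrow> (nat \<Rightarrow> real^'d) \<Rightarrow> nat \<Rightarrow> real^'v^'v" where
  "spectral_projection Q lam gam m = (\<Sum>n | lam n = gam m. rank_one (column n Q))"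

definition graph_fourier ::
  "real^'v^'v \<Rightarrow> ('v::finite \<Rightarrow> real^'d::finite) \<Rightarrow> (nat \<Rightarrow> real^'d) \<Rightarrow> real^'v \<Rightarrow> nat \<Rightarrow> real^'v" where
  "graph_fourier Q lam gam x m = spectral_projection Q lam gam m *v x"

definition band_space ::
  "real^'v^'v \<Rightarrow> ('v::finite \<Rightarrow> real^'d::finite) \<Rightarrow> nat \<Rightarrow> (nat \<Rightarrow> real^'d) \<Rightarrow> nat set \<Rightarrow> (real^'v) set"
  where
  "band_space Q lam M gam \<Omega> = {x. \<forall>m\<in>{1..M} - \<Omega>. graph_fourier Q lam gam x m = 0}"

definition bandlimited ::
  "real^'v^'v \<Rightarrow> ('v::finite \<Rightarrow> real^'d::finite) \<Rightarrow> nat \<Rightarrow> (nat \<Rightarrow> real^'d) \<Rightarrow> (real^'v) set \<Rightarrow> bool" where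
  "bandlimited Q lam M gam U \<longleftrightarrow> (\<exists>\<Omega>\<subseteq>{1..M}. U = band_space Q lam M gam \<Omega>)"


subsection \<open>Polynomial filters\<close>

primrec mat_power :: "real^'v^'v \<Rightarrow> nat \<Rightarrow> real^'v^'v::finite" where
  "mat_power A 0 = mat 1"
| "mat_power A (Suc k) = A ** mat_power A k"

text \<open>
  Real polynomials in variables indexed by \<open>'d\<close> are finitely supported maps from exponent vectors
  to coefficients.
\<close>

type_synonym 'd real_mpoly = "('d \<Rightarrow>\<^sub>0 nat) \<Rightarrow>\<^sub>0 real"

definition eval_monomial ::
  "('d::{finite,linorder} \<Rightarrow> real^'v^'v) \<Rightarrow> ('d \<Rightarrow>\<^sub>0 nat) \<Rightarrow> real^'v^'v::finite" where
  "eval_monomial S a =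
     foldr (\<lambda>l A. mat_power (S l) (Poly_Mapping.lookup a l) ** A)
       (sorted_list_of_set UNIV) (mat 1)"

definition eval_mpoly ::
  "('d::{finite,linorder} \<Rightarrow> real^'v^'v) \<Rightarrow> 'd real_mpoly \<Rightarrow> real^'v^'v::finite" where
  "eval_mpoly S h = (\<Sum>a\<in>Poly_Mapping.keys h. Poly_Mapping.lookup h a *\<^sub>R eval_monomial S a)"

definition polynomial_filter ::
  "('d::{finite,linorder} \<Rightarrow> real^'v^'v) \<Rightarrow> real^'v^'v::finite \<Rightarrow> bool" where
  "polynomial_filter S A \<longleftrightarrow> (\<exists>h. A = eval_mpoly S h)"


subsection \<open>Graph reproducing kernel Hilbert spaces\<close>

text \<open>
  A Hilbert space of graph signals is a pair of a linear subspace \<open>H\<close> and a function \<open>ip\<close>, of which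
  only the values on \<open>H\<close> matter.
\<close>

definition inner_product_on ::
  "(real^'v::finite) set \<Rightarrow> (real^'v \<Rightarrow> real^'v \<Rightarrow> real) \<Rightarrow> bool" where
  "inner_product_on H ip \<longleftrightarrow>
     (\<forall>x\<in>H. \<forall>y\<in>H. ip x y = ip y x) \<and>
     (\<forall>x\<in>H. \<forall>y\<in>H. \<forall>z\<in>H. ip (x + y) z = ip x z + ip y z) \<and>
     (\<forall>c. \<forall>x\<in>H. \<forall>y\<in>H. ip (c *\<^sub>R x) y = c * ip x y) \<and>
     (\<forall>x\<in>H. x \<noteq> 0 \<longrightarrow> ip x x > 0)"

definition ip_norm :: "(real^'v::finite \<Rightarrow> real^'v \<Rightarrow> real) \<Rightarrow> real^'v \<Rightarrow> real" where
  "ip_norm ip x = sqrt (ip x x)"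

definition complete_wrt ::
  "(real^'v::finite) set \<Rightarrow> (real^'v \<Rightarrow> real^'v \<Rightarrow> real) \<Rightarrow> bool" where
  "complete_wrt H ip \<longleftrightarrow>
     (\<forall>f :: nat \<Rightarrow> real^'v.
        (\<forall>n. f n \<in> H) \<and>
        (\<forall>e>0. \<exists>n0. \<forall>m\<ge>n0. \<forall>n\<ge>n0. ip_norm ip (f m - f n) < e)
        \<longrightarrow> (\<exists>x\<in>H. (\<lambda>n. ip_norm ip (f n - x)) \<longlonglongrightarrow> 0))"

definition signal_hilbert_space ::
  "(real^'v::finite) set \<Rightarrow> (real^'v \<Rightarrow> real^'v \<Rightarrow> real) \<Rightarrow> bool" where
  "signal_hilbert_space H ip \<longleftrightarrow> subspace H \<and> inner_product_on H ip \<and> complete_wrt H ip"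

definition GRKHS ::
  "(real^'v::finite) set \<Rightarrow> (real^'v \<Rightarrow> real^'v \<Rightarrow> real) \<Rightarrow> bool" where
  "GRKHS H ip \<longleftrightarrow>
     signal_hilbert_space H ip \<and>
     (\<forall>v. \<exists>C>0. \<forall>x\<in>H. \<bar>x $ v\<bar> \<le> C * ip_norm ip x)"

text \<open>The reproducing kernel of a GRKHS exists and is unique, so a predicate identifies it.\<close>

definition reproducing_kernel ::
  "(real^'v::finite) set \<Rightarrow> (real^'v \<Rightarrow> real^'v \<Rightarrow> real) \<Rightarrow> real^'v^'v \<Rightarrow> bool" where
  "reproducing_kernel H ip K \<longleftrightarrow>
     (\<forall>v. column v K \<in> H) \<and> (\<forall>x\<in>H. \<forall>v. x $ v = ip x (column v K))"

definition SIGRKHS ::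
  "('d \<Rightarrow> real^'v^'v) \<Rightarrow> (real^'v::finite) set \<Rightarrow> (real^'v \<Rightarrow> real^'v \<Rightarrow> real) \<Rightarrow> bool" where
  "SIGRKHS S H ip \<longleftrightarrow>
     GRKHS H ip \<and> (\<exists>K. reproducing_kernel H ip K \<and> (\<forall>l. K ** S l = S l ** K))"

end

theory Submission
  imports Defs
begin

text \<open>
  Polynomial filters are exactly the matrices that are diagonal in the joint eigenbasis with entries
  \<open>f (\<lambda>(n))\<close> for a polynomial \<open>f\<close>, and by interpolation on the finite joint spectrum \<open>f\<close> may be any
  function. With the standard inner product the reproducing kernel of \<open>U\<close> is the orthogonal
  projection onto \<open>U\<close>. So a polynomial kernel fixes precisely the signals supported where \<open>f = 1\<close>, a
  union of joint eigenspaces, while the projection onto such a union is the filter of its indicator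
  function.
\<close>

subsection \<open>Matrices diagonal in a fixed orthonormal basis\<close>

text \<open>This is \<open>Q ** D ** transpose Q\<close> with \<open>D\<close> the diagonal matrix
  of \<open>g\<close>. As a sum of rank-one terms it covers both the shifts and the spectral
  projections. A function \<open>f\<close> of the joint spectrum is the case of
  \<open>g n = f (lam n)\<close>.\<close>

definition spectral_filter :: "real^'v^'v \<Rightarrow> ('v::finite \<Rightarrow> real) \<Rightarrow> real^'v^'v" where
  "spectral_filter Q g = (\<Sum>n\<in>UNIV. g n *\<^sub>R rank_one (column n Q))"

lemma rank_one_nth: "rank_one u $ i $ j = u $ i * u $ j"
  by (simp add: rank_one_def matrix_matrix_mult_def columnvector_def rowvector_def)

lemma rank_one_mult_vec: "rank_one u *v x = (u \<bullet> x) *\<^sub>R u"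
  by (simp add: vec_eq_iff matrix_vector_mult_def rank_one_nth inner_vec_def sum_distrib_left
      mult_ac)

lemma spectral_filter_mult_vec:
  "spectral_filter Q g *v x = (\<Sum>n\<in>UNIV. (g n * (column n Q \<bullet> x)) *\<^sub>R column n Q)"
proof -
  have "linear (\<lambda>A. A *v x)"
    by (rule linearI) (simp_all add: matrix_vector_mult_add_rdistrib scaleR_matrix_vector_assoc)
  then show ?thesis
    unfolding spectral_filter_def
    by (subst linear_sum[where f = "\<lambda>A. A *v x"])
      (simp_all add: rank_one_mult_vec flip: scaleR_matrix_vector_assoc)
qed

lemma transpose_spectral_filter: "transpose (spectral_filter Q g) = spectral_filter Q g"
  by (simp add: vec_eq_iff transpose_def spectral_filter_def rank_one_nth mult_ac)

lemma spectral_filter_add: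
  "spectral_filter Q (\<lambda>n. g n + h n) = spectral_filter Q g + spectral_filter Q h"
  by (simp add: spectral_filter_def scaleR_add_left sum.distrib)

lemma spectral_filter_scaleR: "spectral_filter Q (\<lambda>n. c * g n) = c *\<^sub>R spectral_filter Q g"
  by (simp add: spectral_filter_def scaleR_sum_right)

lemma spectral_filter_sum:
  "spectral_filter Q (\<lambda>n. \<Sum>a\<in>A. g a n) = (\<Sum>a\<in>A. spectral_filter Q (g a))"
  unfolding spectral_filter_def scaleR_sum_left by (rule sum.swap)

lemma transpose_mult_vec_nth: "(transpose Q *v x) $ n = column n Q \<bullet> x"
  for Q :: "real^'v::finite^'v"
  by (simp add: matrix_vector_mult_def transpose_def column_def inner_vec_def)

lemma inner_columns_orthogonal_matrix:
  fixes Q :: "real^'v::finite^'v"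
  assumes "orthogonal_matrix Q"
  shows "column m Q \<bullet> column n Q = (if m = n then 1 else 0)"
proof -
  have "(transpose Q ** Q) $ m $ n = column m Q \<bullet> column n Q"
    by (simp add: matrix_matrix_mult_def transpose_def column_def inner_vec_def)
  with assms show ?thesis
    by (simp add: orthogonal_matrix_def mat_def)
qed

text \<open>The inner products are the coordinates \<open>transpose Q *v x\<close>, and
  \<open>Q ** transpose Q = mat 1\<close> recovers \<open>x\<close> from them. Identities between
  vectors and matrices can thus be checked coordinate by coordinate.\<close>

lemma eq_if_inner_columns_eq:
  fixes Q :: "real^'v::finite^'v"
  assumes "orthogonal_matrix Q" and "\<And>n. column n Q \<bullet> x = column n Q \<bullet> y"
  shows "x = y"
proof -
  have "transpose Q *v x = transpose Q *v y"
    unfolding vec_eq_iff transpose_mult_vec_nth by (simp only: assms(2) simp_thms)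
  then have "Q *v (transpose Q *v x) = Q *v (transpose Q *v y)"
    by simp
  with assms(1) show ?thesis
    unfolding matrix_vector_mul_assoc orthogonal_matrix_def by simp
qed

text \<open>By orthonormality only the term \<open>n = m\<close> survives. Products, the identity
  and fixed points of filters thereby reduce to statements about real numbers.\<close>

lemma inner_column_spectral_filter:
  assumes "orthogonal_matrix Q"
  shows "column m Q \<bullet> (spectral_filter Q g *v x) = g m * (column m Q \<bullet> x)"
  by (simp add: spectral_filter_mult_vec inner_sum_right inner_columns_orthogonal_matrix[OF assms]
      if_distrib cong: if_cong)

lemma spectral_filter_mult:
  assumes "orthogonal_matrix Q"
  shows "spectral_filter Q g ** spectral_filter Q h = spectral_filter Q (\<lambda>n. g n * h n)"
  unfolding matrix_eq
  by (intro allI eq_if_inner_columns_eq[OF assms])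
    (simp add: inner_column_spectral_filter[OF assms] flip: matrix_vector_mul_assoc)

lemma spectral_filter_const_1:
  assumes "orthogonal_matrix Q"
  shows "spectral_filter Q (\<lambda>_. 1) = mat 1"
  unfolding matrix_eq
  by (intro allI eq_if_inner_columns_eq[OF assms])
    (simp add: inner_column_spectral_filter[OF assms])

lemma spectral_filter_fixes_iff:
  assumes "orthogonal_matrix Q"
  shows "spectral_filter Q g *v x = x \<longleftrightarrow> (\<forall>n. g n \<noteq> 1 \<longrightarrow> column n Q \<bullet> x = 0)"
proof -
  have "spectral_filter Q g *v x = x \<longleftrightarrow> (\<forall>n. g n * (column n Q \<bullet> x) = column n Q \<bullet> x)"
    by (metis inner_column_spectral_filter[OF assms] eq_if_inner_columns_eq[OF assms])
  then show ?thesis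
    by auto
qed

lemma joint_diagonalization_spectral_filter:
  assumes "joint_diagonalization S Q lam"
  shows "S l = spectral_filter Q (\<lambda>n. lam n $ l)"
  using assms by (simp add: joint_diagonalization_def spectral_filter_def)


subsection \<open>Bandlimited spaces\<close>

text \<open>The spectral projection is the filter of the indicator of \<open>lam n = gam m\<close>,
  so it keeps exactly the coordinates in that joint eigenspace.\<close>

lemma graph_fourier_eq_0_iff:
  assumes "orthogonal_matrix Q"
  shows "graph_fourier Q lam gam x m = 0 \<longleftrightarrow> (\<forall>n. lam n = gam m \<longrightarrow> column n Q \<bullet> x = 0)"
proof -
  have "spectral_projection Q lam gam m = spectral_filter Q (\<lambda>n. of_bool (lam n = gam m))"
    unfolding spectral_projection_def spectral_filter_def
    by (rule sum.mono_neutral_cong_left) auto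
  then have "column n Q \<bullet> graph_fourier Q lam gam x m = of_bool (lam n = gam m) * (column n Q \<bullet> x)"
    for n
    by (simp add: graph_fourier_def inner_column_spectral_filter[OF assms])
  moreover have "graph_fourier Q lam gam x m = 0
      \<longleftrightarrow> (\<forall>n. column n Q \<bullet> graph_fourier Q lam gam x m = 0)"
    using eq_if_inner_columns_eq[OF assms, of _ 0] by auto
  ultimately show ?thesis
    by auto
qed

text \<open>Replaces the condition on indices \<open>m\<close> by one on joint eigenvalues, the form
  in which functions on the spectrum can be compared with it.\<close>

lemma band_space_eq:
  assumes "orthogonal_matrix Q" and "bij_betw gam {1..M} (range lam)" and "\<Omega> \<subseteq> {1..M}"
  shows "band_space Q lam M gam \<Omega> = {x. \<forall>n. lam n \<notin> gam ` \<Omega> \<longrightarrow> column n Q \<bullet> x = 0}"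
proof -
  have "gam ` {1..M} = range lam" "inj_on gam {1..M}"
    using assms(2) by (simp_all add: bij_betw_def)
  \<comment> \<open>Injectivity of \<open>gam\<close> lets the image commute with the set
    difference.\<close>
  then have "gam ` ({1..M} - \<Omega>) = range lam - gam ` \<Omega>"
    using assms(3) by (simp add: inj_on_image_set_diff[of gam "{1..M}"])
  then have "lam n \<notin> gam ` \<Omega> \<longleftrightarrow> (\<exists>m\<in>{1..M} - \<Omega>. lam n = gam m)" for n
    by blast
  then show ?thesis
    by (auto simp: band_space_def graph_fourier_eq_0_iff[OF assms(1)])
qed


subsection \<open>Polynomial filters are the functions of the joint spectrum\<close>

lemma mat_power_spectral_filter:
  assumes "orthogonal_matrix Q"
  shows "mat_power (spectral_filter Q g) k = spectral_filter Q (\<lambda>n. g n ^ k)"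
  by (induction k)
    (simp_all add: spectral_filter_mult[OF assms] spectral_filter_const_1[OF assms])

lemma eval_monomial_spectral_filter:
  assumes "joint_diagonalization S Q lam"
  shows "eval_monomial S a = spectral_filter Q (\<lambda>n. \<Prod>l\<in>UNIV. (lam n $ l) ^ Poly_Mapping.lookup a l)"
proof -
  have Q: "orthogonal_matrix Q"
    using assms by (simp add: joint_diagonalization_def)
  \<comment> \<open>The claim is made for every list of factors so that induction applies to the
    fold.\<close>
  have "foldr (\<lambda>l A. mat_power (S l) (Poly_Mapping.lookup a l) ** A) ls (mat 1)
      = spectral_filter Q (\<lambda>n. \<Prod>l\<leftarrow>ls. (lam n $ l) ^ Poly_Mapping.lookup a l)" for ls
    by (induction ls)
      (simp_all add: joint_diagonalization_spectral_filter[OF assms] mat_power_spectral_filter[OF Q]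
        spectral_filter_mult[OF Q] spectral_filter_const_1[OF Q])
  then show ?thesis
    by (simp add: eval_monomial_def flip: prod.distinct_set_conv_list)
qed

text \<open>Addition and scaling may cancel coefficients and so shrink the support; summing over a
  common finite superset avoids tracking this.\<close>

lemma eval_mpoly_superset:
  assumes "finite A" and "Poly_Mapping.keys h \<subseteq> A"
  shows "eval_mpoly S h = (\<Sum>a\<in>A. Poly_Mapping.lookup h a *\<^sub>R eval_monomial S a)"
  unfolding eval_mpoly_def using assms
  by (intro sum.mono_neutral_left) (auto simp: in_keys_iff)

lemma eval_mpoly_add: "eval_mpoly S (h + k) = eval_mpoly S h + eval_mpoly S k"
  using keys_add[of h k]
  by (simp add: eval_mpoly_superset[where A = "Poly_Mapping.keys h \<union> Poly_Mapping.keys k"] lookup_add scaleR_add_left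
      sum.distrib)

lemma eval_mpoly_scale: "eval_mpoly S (Poly_Mapping.map ((*) c) h) = c *\<^sub>R eval_mpoly S h"
proof -
  have "Poly_Mapping.keys (Poly_Mapping.map ((*) c) h) \<subseteq> Poly_Mapping.keys h"
    by (auto simp: in_keys_iff Poly_Mapping.map.rep_eq when_def)
  then show ?thesis
    by (simp add: eval_mpoly_superset[where A = "Poly_Mapping.keys h"] Poly_Mapping.map.rep_eq when_def
        scaleR_sum_right in_keys_iff)
qed

lemma subspace_polynomial_filter: "subspace {A. polynomial_filter S A}"
proof -
  have "0 = eval_mpoly S 0"
    by (simp add: eval_mpoly_def)
  then show ?thesis
    by (auto simp: subspace_def polynomial_filter_def simp flip: eval_mpoly_add eval_mpoly_scale)
qed

lemma polynomial_filter_eval_monomial: "polynomial_filter S (eval_monomial S a)"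
  unfolding polynomial_filter_def
  by (rule exI[of _ "Poly_Mapping.single a 1"]) (simp add: eval_mpoly_def)

text \<open>With this description, closure under products follows from the products of monomials by
  linearity, without multiplying polynomials.\<close>

lemma polynomial_filter_iff_span:
  "polynomial_filter S A \<longleftrightarrow> A \<in> span (range (eval_monomial S))"
proof
  show "A \<in> span (range (eval_monomial S))" if "polynomial_filter S A"
    using that
    by (auto simp: polynomial_filter_def eval_mpoly_def intro!: span_sum intro: span_scale span_base)
  show "polynomial_filter S A" if "A \<in> span (range (eval_monomial S))"
  proof -
    have "range (eval_monomial S) \<subseteq> {A. polynomial_filter S A}"
      by (auto simp: polynomial_filter_eval_monomial)
    from span_minimal[OF this subspace_polynomial_filter] that show ?thesis
      by blast
  qed
qed

text \<open>Filters act diagonally, so evaluating \<open>h\<close> at the shifts evaluates it at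
  each \<open>lam n\<close>; \<open>f\<close> is the polynomial function of
  \<open>h\<close>.\<close>

lemma polynomial_filter_spectral_filter:
  assumes "joint_diagonalization S Q lam" and "polynomial_filter S A"
  obtains f where "A = spectral_filter Q (\<lambda>n. f (lam n))"
proof -
  from assms(2) obtain h where "A = eval_mpoly S h"
    by (auto simp: polynomial_filter_def)
  then have "A = spectral_filter Q
      (\<lambda>n. \<Sum>a\<in>Poly_Mapping.keys h. Poly_Mapping.lookup h a * (\<Prod>l\<in>UNIV. (lam n $ l) ^ Poly_Mapping.lookup a l))"
    by (simp add: eval_mpoly_def eval_monomial_spectral_filter[OF assms(1)] spectral_filter_sum
        spectral_filter_scaleR)
  then show thesis
    by (rule that[of "\<lambda>x. \<Sum>a\<in>Poly_Mapping.keys h. Poly_Mapping.lookup h a * (\<Prod>l\<in>UNIV. (x $ l) ^ Poly_Mapping.lookup a l)"])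
qed

text \<open>Exponents add when monomials in jointly diagonalized shifts are multiplied, and the
  matrix product is bilinear.\<close>

lemma polynomial_filter_mult:
  assumes "joint_diagonalization S Q lam" and "polynomial_filter S A" and "polynomial_filter S B"
  shows "polynomial_filter S (A ** B)"
proof -
  have Q: "orthogonal_matrix Q"
    using assms(1) by (simp add: joint_diagonalization_def)
  have monomials: "eval_monomial S a ** eval_monomial S b = eval_monomial S (a + b)" for a b
    by (simp add: eval_monomial_spectral_filter[OF assms(1)] spectral_filter_mult[OF Q]
        lookup_add power_add prod.distrib)
  let ?P = "span (range (eval_monomial S))"
  have lin: "linear (\<lambda>X. X ** Y)" "linear (\<lambda>X. Y ** X)" for Y :: "real^'b^'b"
    by (auto intro!: linearI
        simp: vec_eq_iff matrix_matrix_mult_def algebra_simps sum.distrib sum_distrib_left)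
  \<comment> \<open>Bilinear extension in two stages: the right factor first, against a fixed
    monomial, and then the left one.\<close>
  have "eval_monomial S a ** Y \<in> ?P" if "Y \<in> ?P" for a Y
  proof -
    have "(\<lambda>X. eval_monomial S a ** X) ` ?P \<subseteq> ?P"
      unfolding linear_span_image[OF lin(2), symmetric]
      by (intro span_minimal) (auto simp: monomials intro: span_base)
    with that show ?thesis by blast
  qed
  then have "(\<lambda>X. X ** Y) ` ?P \<subseteq> ?P" if "Y \<in> ?P" for Y
    unfolding linear_span_image[OF lin(1), symmetric]
    using that by (intro span_minimal) auto
  with assms show ?thesis
    by (auto simp: polynomial_filter_iff_span)
qed

lemma polynomial_filter_mat_1:
  assumes "joint_diagonalization S Q lam"
  shows "polynomial_filter S (mat 1)"
proof -
  have "eval_monomial S 0 = mat 1"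
    using assms
    by (simp add: eval_monomial_spectral_filter[OF assms] spectral_filter_const_1
        joint_diagonalization_def)
  then show ?thesis
    by (metis polynomial_filter_eval_monomial)
qed

lemma polynomial_filter_shift:
  assumes "joint_diagonalization S Q lam"
  shows "polynomial_filter S (S l)"
proof -
  have "(\<Prod>k\<in>UNIV. (lam n $ k) ^ Poly_Mapping.lookup (Poly_Mapping.single l 1) k) = lam n $ l" for n
    by (subst prod.remove[of _ l]) (auto simp: lookup_single when_def intro: prod.neutral)
  then have "eval_monomial S (Poly_Mapping.single l 1) = S l"
    by (simp add: eval_monomial_spectral_filter[OF assms]
        joint_diagonalization_spectral_filter[OF assms, of l])
  then show ?thesis
    by (metis polynomial_filter_eval_monomial)
qed

text \<open>The factor of the Lagrange polynomial vanishing at \<open>y\<close> can be taken affine in one coordinate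
  that separates \<open>y\<close> from \<open>x\<close>.\<close>

lemma polynomial_filter_separation:
  fixes lam :: "'v::finite \<Rightarrow> real^'d::{finite,linorder}"
  assumes "joint_diagonalization S Q lam" and "finite T" and "x \<notin> T"
  obtains f where "polynomial_filter S (spectral_filter Q (\<lambda>n. f (lam n)))"
    and "f x = 1" and "\<forall>y\<in>T. f y = 0"
proof -
  have Q: "orthogonal_matrix Q"
    using assms(1) by (simp add: joint_diagonalization_def)
  have "\<exists>f. polynomial_filter S (spectral_filter Q (\<lambda>n. f (lam n))) \<and> f x = 1 \<and> (\<forall>y\<in>T. f y = 0)"
    using assms(2,3)
  proof (induction T)
    case empty
    show ?case
      by (rule exI[of _ "\<lambda>_. 1"])
        (simp add: spectral_filter_const_1[OF Q] polynomial_filter_mat_1[OF assms(1)])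
  next
    case (insert y T)
    then obtain f where f: "polynomial_filter S (spectral_filter Q (\<lambda>n. f (lam n)))"
      "f x = 1" "\<forall>y\<in>T. f y = 0"
      by auto
    from insert.prems obtain l where l: "x $ l \<noteq> y $ l"
      by (auto simp: vec_eq_iff)
    define c where "c = inverse (x $ l - y $ l)"
    \<comment> \<open>The constant is written as a multiple of \<open>1\<close> so that linearity
      turns \<open>g\<close> into a combination of \<open>S l\<close> and
      \<open>mat 1\<close>.\<close>
    define g where "g z = c * (z $ l + (- (y $ l)) * 1)" for z
    have "spectral_filter Q (\<lambda>n. g (lam n)) = c *\<^sub>R (S l + (- (y $ l)) *\<^sub>R mat 1)"
      unfolding g_def spectral_filter_scaleR spectral_filter_add spectral_filter_const_1[OF Q]
      by (simp flip: joint_diagonalization_spectral_filter[OF assms(1)])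
    also have "\<dots> \<in> {A. polynomial_filter S A}"
      by (intro subspace_scale subspace_add subspace_polynomial_filter)
        (simp_all add: polynomial_filter_shift[OF assms(1)] polynomial_filter_mat_1[OF assms(1)])
    finally have "polynomial_filter S
        (spectral_filter Q (\<lambda>n. f (lam n)) ** spectral_filter Q (\<lambda>n. g (lam n)))"
      using polynomial_filter_mult[OF assms(1) f(1)] by simp
    then have "polynomial_filter S (spectral_filter Q (\<lambda>n. f (lam n) * g (lam n)))"
      by (simp add: spectral_filter_mult[OF Q])
    moreover have "g x = 1" "g y = 0"
      using l by (simp_all add: g_def c_def)
    ultimately show ?case
      using f(2,3) by (intro exI[of _ "\<lambda>z. f z * g z"]) auto
  qed
  then show thesis
    using that by blast
qed

text \<open>Lagrange interpolation on the finite set \<open>range lam\<close>: the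
  \<open>p x\<close> below act as Kronecker deltas there, and \<open>f\<close> is their combination
  with weights \<open>f x\<close>.\<close>

lemma polynomial_filter_interpolation:
  assumes "joint_diagonalization S Q lam"
  shows "polynomial_filter S (spectral_filter Q (\<lambda>n. f (lam n)))"
proof -
  have "\<exists>p. polynomial_filter S (spectral_filter Q (\<lambda>n. p (lam n))) \<and> p x = 1
      \<and> (\<forall>y\<in>range lam - {x}. p y = 0)" for x
  proof -
    obtain p where "polynomial_filter S (spectral_filter Q (\<lambda>n. p (lam n)))" "p x = 1"
      "\<forall>y\<in>range lam - {x}. p y = 0"
      by (rule polynomial_filter_separation[OF assms, of "range lam - {x}" x]) auto
    then show ?thesis
      by blast
  qed
  then obtain p where p: "polynomial_filter S (spectral_filter Q (\<lambda>n. p x (lam n)))"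
    "p x x = 1" "\<forall>y\<in>range lam - {x}. p x y = 0" for x
    by metis
  have "(\<Sum>x\<in>range lam. f x * p x (lam n)) = f (lam n)" for n
  proof -
    have "(\<Sum>x\<in>range lam. f x * p x (lam n)) = (\<Sum>x\<in>range lam. if x = lam n then f x else 0)"
      using p(2,3) by (intro sum.cong) auto
    then show ?thesis by simp
  qed
  then have "spectral_filter Q (\<lambda>n. f (lam n))
      = (\<Sum>x\<in>range lam. f x *\<^sub>R spectral_filter Q (\<lambda>n. p x (lam n)))"
    by (simp flip: spectral_filter_scaleR spectral_filter_sum)
  also have "\<dots> \<in> {A. polynomial_filter S A}"
    by (intro subspace_sum subspace_scale subspace_polynomial_filter) (simp add: p(1))
  finally show ?thesis by simp
qed


subsection \<open>Subspaces with the standard inner product\<close>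

text \<open>Subspaces of a finite-dimensional space are complete, and each coordinate is bounded by
  the norm.\<close>

lemma GRKHS_inner:
  assumes "subspace U"
  shows "GRKHS U (\<lambda>x y. x \<bullet> y)"
proof -
  have norm: "ip_norm (\<lambda>x y. x \<bullet> y) x = norm x" for x :: "real^'a"
    by (simp add: ip_norm_def norm_eq_sqrt_inner)
  have "complete_wrt U (\<lambda>x y. x \<bullet> y)"
    unfolding complete_wrt_def norm
  proof (intro allI impI)
    fix f :: "nat \<Rightarrow> real^'a"
    assume "(\<forall>n. f n \<in> U) \<and> (\<forall>e>0. \<exists>n0. \<forall>m\<ge>n0. \<forall>n\<ge>n0. norm (f m - f n) < e)"
    then have "\<forall>n. f n \<in> U" "Cauchy f"
      by (auto simp: Cauchy_def dist_norm)
    then obtain x where "x \<in> U" "f \<longlonglongrightarrow> x"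
      using complete_subspace[OF assms] by (auto simp: complete_def)
    then show "\<exists>x\<in>U. (\<lambda>n. norm (f n - x)) \<longlonglongrightarrow> 0"
      using LIM_zero tendsto_norm_zero by blast
  qed
  moreover have "inner_product_on U (\<lambda>x y. x \<bullet> y)"
    by (auto simp: inner_product_on_def inner_add_left intro: inner_commute)
  moreover have "\<exists>C>0. \<forall>x\<in>U. \<bar>x $ v\<bar> \<le> C * norm x" for v
    by (rule exI[of _ 1]) (simp add: component_le_norm_cart)
  ultimately show ?thesis
    using assms by (simp add: GRKHS_def signal_hilbert_space_def norm)
qed

text \<open>For symmetric \<open>K\<close>, pairing \<open>x\<close> with column \<open>v\<close>
  gives \<open>(K *v x) $ v\<close>, so reproduction says that \<open>K\<close> fixes
  \<open>U\<close>. As the columns span the range, \<open>K\<close> is the orthogonal projection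
  onto \<open>U\<close>.\<close>

lemma reproducing_kernel_inner_iff:
  assumes "subspace U" and "transpose K = K"
  shows "reproducing_kernel U (\<lambda>x y. x \<bullet> y) K \<longleftrightarrow> range ((*v) K) \<subseteq> U \<and> (\<forall>x\<in>U. K *v x = x)"
proof -
  have "(\<forall>v. column v K \<in> U) \<longleftrightarrow> range ((*v) K) \<subseteq> U"
  proof
    assume "\<forall>v. column v K \<in> U"
    then show "range ((*v) K) \<subseteq> U"
      by (auto simp: matrix_mult_sum scalar_mult_eq_scaleR intro!: subspace_sum subspace_scale assms(1))
  next
    assume "range ((*v) K) \<subseteq> U"
    then show "\<forall>v. column v K \<in> U"
      by (metis matrix_vector_mult_basis rangeI subsetD)
  qed
  moreover have "(K *v x) $ v = x \<bullet> column v K" for x v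
    using transpose_mult_vec_nth[of K x v] by (simp add: assms(2) inner_commute)
  ultimately show ?thesis
    by (auto simp: reproducing_kernel_def vec_eq_iff)
qed

theorem theorem5p2:
  fixes E :: "('v::finite \<times> 'v) set"
    and S :: "'d::{finite,linorder} \<Rightarrow> real^'v^'v"
    and Q :: "real^'v^'v"
    and lam :: "'v \<Rightarrow> real^'d::{finite,linorder}"
    and M :: nat
    and gam :: "nat \<Rightarrow> real^'d::{finite,linorder}"
    and U :: "(real^'v) set"
  assumes "CARD('v) \<ge> 2"
    and "simple_graph E"
    and "shift_family E S"
    and "joint_diagonalization S Q lam"
    and "bij_betw gam {1..M} (range lam)"
    and "subspace U"
  shows "bandlimited Q lam M gam U \<longleftrightarrow>
    SIGRKHS S U (\<lambda>x y. x \<bullet> y) \<and>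
    (\<exists>K. reproducing_kernel U (\<lambda>x y. x \<bullet> y) K \<and> polynomial_filter S K)"
proof -
  note diag = assms(4)
  have Q: "orthogonal_matrix Q"
    using diag by (simp add: joint_diagonalization_def)
  note kernel_iff = reproducing_kernel_inner_iff[OF assms(6) transpose_spectral_filter]
  note band = band_space_eq[OF Q assms(5)]
  show ?thesis
  proof
    assume "bandlimited Q lam M gam U"
    then obtain \<Omega> where \<Omega>: "\<Omega> \<subseteq> {1..M}" "U = band_space Q lam M gam \<Omega>"
      by (auto simp: bandlimited_def)
    \<comment> \<open>The indicator of the band makes \<open>K\<close> the projection onto the joint
      eigenspaces in the band.\<close>
    define K where "K = spectral_filter Q (\<lambda>n. of_bool (lam n \<in> gam ` \<Omega>))"
    have poly: "polynomial_filter S K"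
      unfolding K_def by (rule polynomial_filter_interpolation[OF diag])
    have "reproducing_kernel U (\<lambda>x y. x \<bullet> y) K"
      unfolding K_def kernel_iff
      by (auto simp: \<Omega>(2) band[OF \<Omega>(1)] inner_column_spectral_filter[OF Q]
          spectral_filter_fixes_iff[OF Q])
    moreover have "K ** S l = S l ** K" for l
      unfolding K_def joint_diagonalization_spectral_filter[OF diag, of l]
        spectral_filter_mult[OF Q]
      by (simp add: mult.commute)
    ultimately show "SIGRKHS S U (\<lambda>x y. x \<bullet> y) \<and>
        (\<exists>K. reproducing_kernel U (\<lambda>x y. x \<bullet> y) K \<and> polynomial_filter S K)"
      using poly GRKHS_inner[OF assms(6)] by (auto simp: SIGRKHS_def)
  next
    assume "SIGRKHS S U (\<lambda>x y. x \<bullet> y) \<and>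
        (\<exists>K. reproducing_kernel U (\<lambda>x y. x \<bullet> y) K \<and> polynomial_filter S K)"
    then obtain K where K: "reproducing_kernel U (\<lambda>x y. x \<bullet> y) K" "polynomial_filter S K"
      by blast
    from polynomial_filter_spectral_filter[OF diag K(2)] obtain f
      where f: "K = spectral_filter Q (\<lambda>n. f (lam n))" .
    \<comment> \<open>The band consists of the joint eigenvalues whose eigenvectors \<open>K\<close>
      fixes.\<close>
    define \<Omega> where "\<Omega> = {m \<in> {1..M}. f (gam m) = 1}"
    have \<Omega>: "\<Omega> \<subseteq> {1..M}"
      by (auto simp: \<Omega>_def)
    have "lam n \<in> gam ` {1..M}" for n
      using assms(5) by (simp add: bij_betw_def)
    \<comment> \<open>Since \<open>gam\<close> reaches every \<open>lam n\<close>, the band captures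
      all spectral points where \<open>f\<close> is 1.\<close>
    then have spectrum: "lam n \<in> gam ` \<Omega> \<longleftrightarrow> f (lam n) = 1" for n
      unfolding \<Omega>_def by (force simp: image_iff)
    have "range ((*v) K) \<subseteq> U" "\<forall>x\<in>U. K *v x = x"
      using K(1) unfolding f kernel_iff by auto
    \<comment> \<open>A fixed point lies in the range of \<open>K\<close>, hence in
      \<open>U\<close>; the converse is reproduction.\<close>
    then have "U = {x. K *v x = x}"
      by (metis (mono_tags, lifting) Collect_cong Collect_mem_eq rangeI subsetD)
    also have "\<dots> = band_space Q lam M gam \<Omega>"
      by (simp add: f band[OF \<Omega>] spectrum spectral_filter_fixes_iff[OF Q])
    finally show "bandlimited Q lam M gam U"
      using \<Omega> by (auto simp: bandlimited_def)
  qed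
qed

end
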